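(* Let $n\ge 1$ and let $\boldsymbol{q}=(q_1,\ldots,q_n)$ be complex numbers with $\operatorname{Re} q_k>0$ for all $k$. Let $$G_n(\boldsymbol{q})=\frac{2}{\pi}\int_0^\infty\prod_{k=1}^n\frac{1}{x^2+q_k^2}\,dx .$$ Then $$G_n(\boldsymbol{q})=\frac{s_{\lambda(n-1)}(\boldsymbol{q})}{s_{\lambda(n+1)}(\boldsymbol{q})}=\frac{s_{\lambda(n-1)}(\boldsymbol{q})}{e_n(\boldsymbol{q})\,s_{\lambda(n)}(\boldsymbol{q})}.$$
   Context: For an integer $m$, $\lambda(m)=(m-1,m-2,\ldots,1)$ denotes the staircase partition (empty for $m\le 1$). For a vector $\mu=(\mu_1,\mu_2,\ldots)$ of length at most $n$ (padded with zeros to length $n$), the alternant is $a_\mu(\boldsymbol{q})=\det\big(q_i^{\mu_j}\big)_{1\le i,j\le n}$, and the Schur function is $$s_\mu(\boldsymbol{q})=\frac{a_{\mu+\lambda(n)}(\boldsymbol{q})}{a_{\lambda(n)}(\boldsymbol{q})},$$ where vectors are added componentwise (after padding with zeros) and $a_{\lambda(n)}(\boldsymbol{q})=\prod_{1\le i<j\le n}(q_i-q_j)$. When $\mu$ is a partition, $s_\mu$ is a symmetric polynomial in $q_1,\ldots,q_n$, and it is this polynomial that is evaluated when some of the $q_k$ coincide. $e_n(\boldsymbol{q})=q_1q_2\cdots q_n$ is the $n$-th elementary symmetric function. *)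

theory Defs
  imports
    "HOL-Analysis.Analysis"
    "HOL-Library.Poly_Mapping"
    "HOL-Library.More_List"
    "Jordan_Normal_Form.Determinant"
begin

text \<open>
  Vectors and variables are indexed from \<open>0\<close>: the variables \<open>q\<^sub>1, \<dots>, q\<^sub>n\<close> are
  \<open>q 0, \<dots>, q (n - 1)\<close>. Vectors of exponents are lists, and \<open>nth_default 0 \<mu>\<close> is
  the vector \<open>\<mu>\<close> padded with zeros.
\<close>

definition staircase :: "int \<Rightarrow> nat list" where
  "staircase m = rev [1..<nat m]"

definition alternant :: "nat \<Rightarrow> (nat \<Rightarrow> nat) \<Rightarrow> (nat \<Rightarrow> 'a::comm_ring_1) \<Rightarrow> 'a" where
  "alternant n \<mu> q = Determinant.det (Matrix.mat n n (\<lambda>(i, j). q i ^ \<mu> j))"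

text \<open>
  Polynomials over the complex numbers in indeterminates indexed by the naturals, as finitely
  supported maps from monomials (finitely supported exponent maps) to coefficients.
  They form an integral domain.
\<close>

type_synonym cpoly = "(nat \<Rightarrow>\<^sub>0 nat) \<Rightarrow>\<^sub>0 complex"

definition indet :: "nat \<Rightarrow> cpoly" where
  "indet i = Poly_Mapping.single (Poly_Mapping.single i 1) 1"

definition eval_cpoly :: "(nat \<Rightarrow> complex) \<Rightarrow> cpoly \<Rightarrow> complex" where
  "eval_cpoly q p =
    (\<Sum>m\<in>Poly_Mapping.keys p. Poly_Mapping.lookup p m *
      (\<Prod>i\<in>Poly_Mapping.keys m. q i ^ Poly_Mapping.lookup m i))"

text \<open>
  The quotient of alternants is taken in the polynomial ring, so that it can be evaluated at
  points with coinciding coordinates. It is unique because the ring is an integral domain and the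
  denominator is the nonzero Vandermonde polynomial; it exists when \<open>\<mu>\<close> is a partition of
  length at most \<open>n\<close>, and is unspecified if the division is not exact.
\<close>

definition schur_poly :: "nat \<Rightarrow> nat list \<Rightarrow> cpoly" where
  "schur_poly n \<mu> =
    (THE s. s * alternant n (nth_default 0 (staircase (int n))) indet =
       alternant n (\<lambda>j. nth_default 0 \<mu> j + nth_default 0 (staircase (int n)) j) indet)"

definition schur :: "nat \<Rightarrow> nat list \<Rightarrow> (nat \<Rightarrow> complex) \<Rightarrow> complex" where
  "schur n \<mu> q = eval_cpoly q (schur_poly n \<mu>)"

text \<open>The \<open>n\<close>-th elementary symmetric function of \<open>n\<close> variables.\<close>

definition elem_sym_top :: "nat \<Rightarrow> (nat \<Rightarrow> complex) \<Rightarrow> complex" where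
  "elem_sym_top n q = (\<Prod>k<n. q k)"

definition G :: "nat \<Rightarrow> (nat \<Rightarrow> complex) \<Rightarrow> complex" where
  "G n q = complex_of_real (2 / pi) *
     (LINT x:{0..}|lborel. (\<Prod>k<n. 1 / ((complex_of_real x)\<^sup>2 + (q k)\<^sup>2)))"

end

theory Submission imports Defs begin

text \<open>
  Write \<open>D\<close> for the alternant of \<open>(n - 1, \<dots>, 1, 0)\<close> in the variables \<open>y\<^sub>k = q\<^sub>k\<^sup>2\<close>. Replacing its
  columns by \<open>y\<^sup>n\<^sup>-\<^sup>2, \<dots>, y, 1, 1 / (x\<^sup>2 + y)\<close> multiplies it by \<open>\<Prod>\<^sub>k 1 / (x\<^sup>2 + y\<^sub>k)\<close>; this is the partial
  fraction decomposition in a form free of division by \<open>y\<^sub>i - y\<^sub>j\<close>. The determinant is linear in the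
  last column, so integrating over \<open>x\<close> turns that column into \<open>1 / q\<close>, and pulling \<open>1 / q\<^sub>k\<close> out of
  each row gives \<open>e\<^sub>n G\<^sub>n D = a\<^bsub>\<lambda>(n-1) + \<lambda>(n)\<^esub>\<close>. Dividing by \<open>a\<^bsub>\<lambda>(n)\<^esub>\<close>, where
  \<open>D / a\<^bsub>\<lambda>(n)\<^esub> = \<Prod>\<^sub>i\<^sub><\<^sub>j (q\<^sub>i + q\<^sub>j)\<close>, proves the claim for distinct \<open>q\<^sub>k\<close>. The general case follows by
  continuity along \<open>q\<^sub>k + k / (m + 1)\<close>: shifting \<open>q\<^sub>k\<close> to the right only decreases the modulus of
  the integrand, so the limiting integrand is a dominating function.
\<close>

subsection \<open>Evaluation of polynomials\<close>

definition monomial_value :: "(nat \<Rightarrow> complex) \<Rightarrow> (nat \<Rightarrow>\<^sub>0 nat) \<Rightarrow> complex" where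
  "monomial_value q m = (\<Prod>i\<in>Poly_Mapping.keys m. q i ^ Poly_Mapping.lookup m i)"

text \<open>Exponents off the support are 0, so two monomials can be evaluated over a common index
  set, where exponents simply add.\<close>

lemma monomial_value_superset:
  assumes "finite S" "Poly_Mapping.keys m \<subseteq> S"
  shows "monomial_value q m = (\<Prod>i\<in>S. q i ^ Poly_Mapping.lookup m i)"
  unfolding monomial_value_def
  by (rule prod.mono_neutral_left[OF assms]) (auto simp: in_keys_iff)

lemma monomial_value_add:
  "monomial_value q (m + m') = monomial_value q m * monomial_value q m'"
proof -
  let ?S = "Poly_Mapping.keys m \<union> Poly_Mapping.keys m'"
  have "monomial_value q (m + m') = (\<Prod>i\<in>?S. q i ^ Poly_Mapping.lookup (m + m') i)"
    by (rule monomial_value_superset) (auto simp: Poly_Mapping.keys_add)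
  also have "\<dots> = (\<Prod>i\<in>?S. q i ^ Poly_Mapping.lookup m i)
      * (\<Prod>i\<in>?S. q i ^ Poly_Mapping.lookup m' i)"
    by (simp add: lookup_add power_add prod.distrib)
  also have "\<dots> = monomial_value q m * monomial_value q m'"
    by (subst (1 2) monomial_value_superset[of ?S]) auto
  finally show ?thesis .
qed

lemma eval_cpoly_superset:
  assumes "finite S" "Poly_Mapping.keys p \<subseteq> S"
  shows "eval_cpoly q p = (\<Sum>m\<in>S. Poly_Mapping.lookup p m * monomial_value q m)"
  unfolding eval_cpoly_def monomial_value_def[symmetric]
  by (rule sum.mono_neutral_left[OF assms]) (auto simp: in_keys_iff)

lemma eval_cpoly_add: "eval_cpoly q (p + p') = eval_cpoly q p + eval_cpoly q p'"
proof -
  let ?S = "Poly_Mapping.keys p \<union> Poly_Mapping.keys p'"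
  have "eval_cpoly q (p + p') = (\<Sum>m\<in>?S. Poly_Mapping.lookup (p + p') m * monomial_value q m)"
    by (rule eval_cpoly_superset) (auto simp: Poly_Mapping.keys_add)
  also have "\<dots> = (\<Sum>m\<in>?S. Poly_Mapping.lookup p m * monomial_value q m)
      + (\<Sum>m\<in>?S. Poly_Mapping.lookup p' m * monomial_value q m)"
    by (simp add: lookup_add algebra_simps sum.distrib)
  also have "\<dots> = eval_cpoly q p + eval_cpoly q p'"
    by (subst (1 2) eval_cpoly_superset[of ?S]) auto
  finally show ?thesis .
qed

lemma eval_cpoly_single:
  "eval_cpoly q (Poly_Mapping.single m c) = c * monomial_value q m"
  by (subst eval_cpoly_superset[of "{m}"]) auto

lemma eval_cpoly_0: "eval_cpoly q 0 = 0"
  by (simp add: eval_cpoly_def)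

lemma eval_cpoly_1: "eval_cpoly q 1 = 1"
  by (simp add: eval_cpoly_single monomial_value_def flip: single_one)

lemma eval_cpoly_sum: "eval_cpoly q (sum f S) = (\<Sum>x\<in>S. eval_cpoly q (f x))"
  by (induction S rule: infinite_finite_induct) (auto simp: eval_cpoly_0 eval_cpoly_add)

lemma poly_mapping_eq_sum_single:
  fixes p :: "'a \<Rightarrow>\<^sub>0 'b::comm_monoid_add"
  shows "p = (\<Sum>m\<in>Poly_Mapping.keys p. Poly_Mapping.single m (Poly_Mapping.lookup p m))"
  by (rule poly_mapping_eqI) (auto simp: lookup_sum lookup_single when_def in_keys_iff)

text \<open>Writing both factors as sums of single terms reduces the claim, by bilinearity, to
  \<open>monomial_value_add\<close>.\<close>

lemma eval_cpoly_mult: "eval_cpoly q (p * p') = eval_cpoly q p * eval_cpoly q p'"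
proof -
  let ?s = "\<lambda>p m. Poly_Mapping.single m (Poly_Mapping.lookup p m) :: cpoly"
  have "eval_cpoly q (p * p') = eval_cpoly q (sum (?s p) (Poly_Mapping.keys p)
      * sum (?s p') (Poly_Mapping.keys p'))"
    using poly_mapping_eq_sum_single[of p] poly_mapping_eq_sum_single[of p'] by simp
  also have "\<dots> = (\<Sum>m\<in>Poly_Mapping.keys p. \<Sum>m'\<in>Poly_Mapping.keys p'.
      eval_cpoly q (?s p m) * eval_cpoly q (?s p' m'))"
    by (simp add: sum_product eval_cpoly_sum mult_single eval_cpoly_single monomial_value_add
        mult_ac)
  also have "\<dots> = eval_cpoly q (sum (?s p) (Poly_Mapping.keys p))
      * eval_cpoly q (sum (?s p') (Poly_Mapping.keys p'))"
    by (simp add: sum_product eval_cpoly_sum)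
  also have "\<dots> = eval_cpoly q p * eval_cpoly q p'"
    using poly_mapping_eq_sum_single[of p] poly_mapping_eq_sum_single[of p'] by simp
  finally show ?thesis .
qed

lemma eval_cpoly_indet: "eval_cpoly q (indet i) = q i"
  by (simp add: indet_def eval_cpoly_single monomial_value_def)

lemma comm_ring_hom_eval_cpoly: "comm_ring_hom (eval_cpoly q)"
  by unfold_locales (auto simp: eval_cpoly_0 eval_cpoly_1 eval_cpoly_add eval_cpoly_mult)

lemma eval_cpoly_prod: "eval_cpoly q (prod f S) = (\<Prod>x\<in>S. eval_cpoly q (f x))"
  by (induction S rule: infinite_finite_induct) (auto simp: eval_cpoly_1 eval_cpoly_mult)

lemma eval_cpoly_power: "eval_cpoly q (p ^ k) = eval_cpoly q p ^ k"
  by (induction k) (auto simp: eval_cpoly_1 eval_cpoly_mult)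

lemma tendsto_eval_cpoly:
  assumes "\<And>i. ((\<lambda>x. f x i) \<longlongrightarrow> q i) F"
  shows "((\<lambda>x. eval_cpoly (f x) p) \<longlongrightarrow> eval_cpoly q p) F"
  unfolding eval_cpoly_def by (intro tendsto_intros assms)

text \<open>Determinants commute with ring homomorphisms, so polynomial identities between
  alternants hold at every point.\<close>

lemma eval_cpoly_alternant: "eval_cpoly q (alternant n \<mu> indet) = alternant n \<mu> q"
proof -
  interpret comm_ring_hom "eval_cpoly q" by (rule comm_ring_hom_eval_cpoly)
  have "map_mat (eval_cpoly q) (Matrix.mat n n (\<lambda>(i, j). indet i ^ \<mu> j))
      = Matrix.mat n n (\<lambda>(i, j). q i ^ \<mu> j)"
    by (rule eq_matI) (auto simp: eval_cpoly_power eval_cpoly_indet)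
  then show ?thesis
    unfolding alternant_def by (metis hom_det)
qed

subsection \<open>Alternants and Schur functions of staircases\<close>

text \<open>Truncated subtraction yields the padding zeros as well.\<close>

lemma nth_default_staircase: "nth_default 0 (staircase m) j = nat m - Suc j"
  by (auto simp: staircase_def nth_default_def rev_nth)

text \<open>The Vandermonde product for increasing exponents; it agrees with the denominator of the
  Schur function up to sign.\<close>

definition diff_prod :: "nat \<Rightarrow> (nat \<Rightarrow> 'a::comm_ring_1) \<Rightarrow> 'a" where
  "diff_prod n q = (\<Prod>i<n. \<Prod>l<i. q i - q l)"

text \<open>By \<open>schur_staircase\<close> below, this is the Schur function of the staircase of
  \<open>n\<close>.\<close>

definition sum_prod :: "nat \<Rightarrow> (nat \<Rightarrow> 'a::comm_ring_1) \<Rightarrow> 'a" where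
  "sum_prod n q = (\<Prod>i<n. \<Prod>l<i. q i + q l)"

lemma diff_prod_square: "diff_prod n (\<lambda>k. (q k)\<^sup>2) = diff_prod n q * sum_prod n q"
  by (simp add: diff_prod_def sum_prod_def power2_eq_square square_diff_square_factored
      mult.commute flip: prod.distrib)

text \<open>
  In the basis of Newton polynomials at the nodes \<open>q\<close>, the alternant matrix factors into a triangular
  matrix with determinant \<^term>\<open>diff_prod n q\<close> and a coefficient matrix. Over any commutative
  ring, this gives both Vandermonde's formula and divisibility of every alternant.
\<close>

lemma newton_coefficients:
  fixes q :: "nat \<Rightarrow> 'a::comm_ring_1"
  shows "\<exists>c. (\<forall>i>m. c i = 0) \<and> c m = 1
    \<and> (\<forall>k<n. q k ^ m = (\<Sum>i<n. c i * (\<Prod>l<i. q k - q l)))"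
proof (induction m)
  case 0
  have "q k ^ 0 = (\<Sum>i<n. (if i = 0 then 1 else 0) * (\<Prod>l<i. q k - q l))" if "k < n" for k
  proof -
    have "(\<Sum>i<n. (if i = 0 then 1 else 0) * (\<Prod>l<i. q k - q l))
        = (\<Sum>i\<in>{0}. (if i = 0 then 1 else 0) * (\<Prod>l<i. q k - q l))"
      by (rule sum.mono_neutral_right) (use that in auto)
    then show ?thesis by simp
  qed
  then show ?case
    by (intro exI[of _ "\<lambda>i. if i = 0 then 1 else 0"]) auto
next
  case (Suc m)
  then obtain c where c: "\<And>i. i > m \<Longrightarrow> c i = 0" "c m = 1"
    "\<And>k. k < n \<Longrightarrow> q k ^ m = (\<Sum>i<n. c i * (\<Prod>l<i. q k - q l))" by blast
  \<comment> \<open>With N_i the Newton polynomial of degree i, x N_i = N_(i+1) + q_i N_i.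
    Multiplying by x therefore shifts the coefficients by one, giving \<open>d\<close>, and adds q_i
    c_i.\<close>
  define d where "d i = (if i = 0 then 0 else c (i - 1))" for i
  have "q k ^ Suc m = (\<Sum>i<n. (d i + q i * c i) * (\<Prod>l<i. q k - q l))" if k: "k < n" for k
  proof -
    let ?N = "\<lambda>i. \<Prod>l<i. q k - q l"
    \<comment> \<open>N_n vanishes at all n nodes, so the term that the shift pushes to index n
      drops out.\<close>
    have N: "?N n = 0" using k by (intro prod_zero) auto
    have "q k ^ Suc m = (\<Sum>i<n. c i * ?N (Suc i) + q i * c i * ?N i)"
      by (simp add: c(3)[OF k] sum_distrib_left algebra_simps)
    also have "\<dots> = (\<Sum>i<n. c i * ?N (Suc i)) + (\<Sum>i<n. q i * c i * ?N i)"
      by (simp add: sum.distrib)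
    also have "(\<Sum>i<n. c i * ?N (Suc i)) = (\<Sum>i<Suc n. d i * ?N i)"
      by (subst sum.lessThan_Suc_shift) (simp add: d_def)
    also have "\<dots> = (\<Sum>i<n. d i * ?N i)" using N by simp
    finally show ?thesis by (simp add: sum.distrib algebra_simps)
  qed
  then show ?case
    by (intro exI[of _ "\<lambda>i. d i + q i * c i"]) (auto simp: d_def c)
qed

lemma alternant_newton:
  fixes q :: "nat \<Rightarrow> 'a::comm_ring_1"
  assumes c: "\<And>j k. \<lbrakk>j < n; k < n\<rbrakk> \<Longrightarrow> q k ^ \<mu> j = (\<Sum>i<n. c j i * (\<Prod>l<i. q k - q l))"
  shows "alternant n \<mu> q = diff_prod n q * Determinant.det (Matrix.mat n n (\<lambda>(i, j). c j i))"
proof -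
  let ?L = "Matrix.mat n n (\<lambda>(k, i). \<Prod>l<i. q k - q l)"
  let ?H = "Matrix.mat n n (\<lambda>(i, j). c j i)"
  have "Matrix.mat n n (\<lambda>(i, j). q i ^ \<mu> j) = ?L * ?H"
    by (rule eq_matI) (auto simp: c scalar_prod_def atLeast0LessThan mult.commute)
  moreover have "Determinant.det ?L = diff_prod n q"
  proof -
    \<comment> \<open>Right of the diagonal, row k contains the factor q_k - q_k.\<close>
    have "Determinant.det ?L = prod_list (diag_mat ?L)"
      by (rule det_lower_triangular[of n]) (auto intro!: prod_zero)
    then show ?thesis
      by (simp add: prod_list_diag_prod diff_prod_def atLeast0LessThan)
  qed
  ultimately show ?thesis
    unfolding alternant_def by (metis det_mult mat_carrier)
qed

text \<open>The quotient is the determinant of the Newton coefficients. This is what makes the Schur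
  polynomial exist.\<close>

lemma diff_prod_dvd_alternant: "diff_prod n q dvd alternant n \<mu> q"
proof -
  have "\<exists>c. \<forall>k<n. q k ^ m = (\<Sum>i<n. c i * (\<Prod>l<i. q k - q l))" for m
    using newton_coefficients[of m n q] by blast
  then obtain c where
    "\<And>j k. k < n \<Longrightarrow> q k ^ \<mu> j = (\<Sum>i<n. c (\<mu> j) i * (\<Prod>l<i. q k - q l))" by metis
  then show ?thesis
    using alternant_newton[of n q \<mu> "\<lambda>j. c (\<mu> j)"] by simp
qed

text \<open>For exponents 0, ..., n - 1 the coefficient matrix is upper triangular with unit
  diagonal.\<close>

lemma vandermonde: "alternant n (\<lambda>j. j) q = diff_prod n q"
proof -
  have "\<forall>j. \<exists>c. (\<forall>i>j. c i = 0) \<and> c j = 1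
    \<and> (\<forall>k<n. q k ^ j = (\<Sum>i<n. c i * (\<Prod>l<i. q k - q l)))"
    by (intro allI newton_coefficients)
  then obtain c where c: "\<And>i j. i > j \<Longrightarrow> c j i = 0" "\<And>j. c j j = 1"
    "\<And>j k. k < n \<Longrightarrow> q k ^ j = (\<Sum>i<n. c j i * (\<Prod>l<i. q k - q l))" by metis
  have "Determinant.det (Matrix.mat n n (\<lambda>(i, j). c j i))
      = prod_list (diag_mat (Matrix.mat n n (\<lambda>(i, j). c j i)))"
    by (rule det_upper_triangular[of _ n]) (auto simp: c)
  also have "\<dots> = 1" by (simp add: prod_list_diag_prod c(2))
  finally show ?thesis
    using alternant_newton[of n q "\<lambda>j. j" c] c(3) by simp
qed

text \<open>The sign that relates decreasing to increasing exponents; only its square matters.\<close>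

definition exchange_det :: "nat \<Rightarrow> 'a::comm_ring_1" where
  "exchange_det n = Determinant.det (Matrix.mat n n (\<lambda>(i, j). of_bool (i = n - Suc j)))"

text \<open>Reversing the indices twice is the identity.\<close>

lemma exchange_det_square: "exchange_det n * exchange_det n = (1 :: 'a::comm_ring_1)"
proof -
  let ?J = "Matrix.mat n n (\<lambda>(i, j). of_bool (i = n - Suc j)) :: 'a mat"
  have "(\<Sum>k = 0..<n. of_bool (i = n - Suc k) * of_bool (k = n - Suc j)) = (of_bool (i = j) :: 'a)"
    if "i < n" "j < n" for i j
  proof -
    have "(\<Sum>k = 0..<n. of_bool (i = n - Suc k) * of_bool (k = n - Suc j))
        = (\<Sum>k = 0..<n. if k = n - Suc j then of_bool (i = n - Suc k) else (0 :: 'a))"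
      by (intro sum.cong) auto
    also have "\<dots> = of_bool (i = j)"
      using that by (subst sum.delta) auto
    finally show ?thesis .
  qed
  then have "?J * ?J = 1\<^sub>m n"
    by (intro eq_matI) (auto simp: scalar_prod_def)
  then show ?thesis
    unfolding exchange_det_def by (metis det_mult det_one mat_carrier)
qed

text \<open>Right multiplication by the exchange matrix reverses the columns of the Vandermonde
  matrix.\<close>

lemma alternant_staircase: "alternant n (\<lambda>j. n - Suc j) q = exchange_det n * diff_prod n q"
proof -
  have "Matrix.mat n n (\<lambda>(i, j). q i ^ (n - Suc j))
      = Matrix.mat n n (\<lambda>(i, j). q i ^ j) * Matrix.mat n n (\<lambda>(i, j). of_bool (i = n - Suc j))"
    by (rule eq_matI) (auto simp: scalar_prod_def of_bool_def if_distrib[of "\<lambda>x. _ * x"] cong: if_cong)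
  then show ?thesis
    using vandermonde[of n q]
    unfolding alternant_def exchange_det_def by (metis det_mult mat_carrier mult.commute)
qed

section \<open>Schur polynomials as exact quotients\<close>

lemma inj_indet: "inj indet"
  \<comment> \<open>Evaluation at the point 0, 1, 2, ... separates the indeterminates.\<close>
  by (rule injI) (metis eval_cpoly_indet of_nat_eq_iff)

lemma alternant_staircase_indet_nonzero: "alternant n (\<lambda>j. n - Suc j) indet \<noteq> (0 :: cpoly)"
proof -
  have "diff_prod n indet \<noteq> (0 :: cpoly)"
    using inj_indet by (auto simp: diff_prod_def inj_def)
  moreover have "exchange_det n \<noteq> (0 :: cpoly)"
    using exchange_det_square[of n, where 'a = cpoly] by auto
  ultimately show ?thesis by (simp add: alternant_staircase)
qed

text \<open>Cancelling the nonzero denominator gives uniqueness, so any quotient that can be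
  exhibited is the one that \<open>THE\<close> selects.\<close>

lemma schur_polyI:
  assumes "s * alternant n (\<lambda>j. n - Suc j) indet
    = alternant n (\<lambda>j. nth_default 0 \<mu> j + (n - Suc j)) indet"
  shows "schur_poly n \<mu> = s"
  unfolding schur_poly_def
proof (rule the_equality)
  fix s' :: cpoly
  assume "s' * alternant n (nth_default 0 (staircase (int n))) indet =
       alternant n (\<lambda>j. nth_default 0 \<mu> j + nth_default 0 (staircase (int n)) j) indet"
  then have "s' * alternant n (\<lambda>j. n - Suc j) indet = s * alternant n (\<lambda>j. n - Suc j) indet"
    by (simp add: nth_default_staircase[abs_def] assms)
  then show "s' = s"
    using alternant_staircase_indet_nonzero[of n] by simp
qed (simp add: nth_default_staircase[abs_def] assms)

text \<open>The defining quotient in division-free form, valid also where coordinates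
  coincide.\<close>

lemma schur_mult_alternant:
  "schur n \<mu> q * (exchange_det n * diff_prod n q)
    = alternant n (\<lambda>j. nth_default 0 \<mu> j + (n - Suc j)) q"
proof -
  let ?A = "alternant n (\<lambda>j. nth_default 0 \<mu> j + (n - Suc j)) indet :: cpoly"
  obtain s where s: "?A = diff_prod n indet * s"
    using diff_prod_dvd_alternant by blast
  \<comment> \<open>\<open>exchange_det n\<close> is its own inverse, so multiplying by it corrects
    the sign of the quotient.\<close>
  have "s * exchange_det n * alternant n (\<lambda>j. n - Suc j) indet
      = (exchange_det n * exchange_det n) * (diff_prod n indet * s)"
    by (simp add: alternant_staircase mult_ac)
  also have "\<dots> = ?A" by (simp add: exchange_det_square s)
  finally have s: "s * exchange_det n * alternant n (\<lambda>j. n - Suc j) indet = ?A" .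
  have "schur n \<mu> q * alternant n (\<lambda>j. n - Suc j) q
      = eval_cpoly q (s * exchange_det n * alternant n (\<lambda>j. n - Suc j) indet)"
    unfolding schur_def schur_polyI[OF s] by (simp only: eval_cpoly_mult eval_cpoly_alternant)
  then show ?thesis
    by (simp only: s eval_cpoly_alternant) (simp only: alternant_staircase)
qed

section \<open>Staircase Schur functions in closed form\<close>

lemma det_scale_rows:
  fixes f :: "nat \<Rightarrow> nat \<Rightarrow> 'a::comm_ring_1"
  shows "Determinant.det (Matrix.mat n n (\<lambda>(i, j). r i * f i j))
    = (\<Prod>i<n. r i) * Determinant.det (Matrix.mat n n (\<lambda>(i, j). f i j))"
proof -
  have "(\<Prod>i = 0..<n. r i * f i (p i)) = (\<Prod>i<n. r i) * (\<Prod>i = 0..<n. f i (p i))" for p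
    by (simp add: prod.distrib atLeast0LessThan)
  moreover have "(\<Prod>i = 0..<n. Matrix.mat n n (\<lambda>(i, j). g i j) $$ (i, p i)) = (\<Prod>i = 0..<n. g i (p i))"
    if "p permutes {0..<n}" for p and g :: "nat \<Rightarrow> nat \<Rightarrow> 'a"
    using permutes_in_image[OF that] by (intro prod.cong) auto
  ultimately show ?thesis
    by (auto simp: det_def'[of _ n] sum_distrib_left mult_ac intro!: sum.cong)
qed

text \<open>Doubling the exponents squares the variables, and each difference of squares splits off
  a sum.\<close>

lemma alternant_double_staircase:
  "alternant n (\<lambda>j. (n - Suc j) + (n - Suc j)) q
    = sum_prod n q * alternant n (\<lambda>j. n - Suc j) q"
proof -
  have "alternant n (\<lambda>j. (n - Suc j) + (n - Suc j)) q = alternant n (\<lambda>j. n - Suc j) (\<lambda>k. (q k)\<^sup>2)"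
    by (simp add: alternant_def flip: power_mult mult_2)
  then show ?thesis
    by (simp add: alternant_staircase diff_prod_square mult_ac)
qed

lemma schur_staircase: "schur n (staircase (int n)) q = sum_prod n q"
proof -
  have "schur_poly n (staircase (int n)) = sum_prod n indet"
    by (rule schur_polyI) (simp add: nth_default_staircase alternant_double_staircase)
  then show ?thesis
    by (simp add: schur_def sum_prod_def eval_cpoly_prod eval_cpoly_add eval_cpoly_indet)
qed

text \<open>Compared with the doubled staircase every exponent grows by one, so row i gains a factor
  q_i.\<close>

lemma schur_staircase_Suc:
  "schur n (staircase (int n + 1)) q = elem_sym_top n q * schur n (staircase (int n)) q"
proof -
  let ?e = "\<Prod>k<n. indet k"
  have "alternant n (\<lambda>j. (n - j) + (n - Suc j)) indet
      = Determinant.det (Matrix.mat n n (\<lambda>(i, j). indet i * indet i ^ ((n - Suc j) + (n - Suc j))))"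
    unfolding alternant_def
    by (intro arg_cong[of _ _ Determinant.det] eq_matI)
      (auto simp: Suc_diff_Suc simp flip: power_Suc)
  also have "\<dots> = ?e * alternant n (\<lambda>j. (n - Suc j) + (n - Suc j)) indet"
    unfolding alternant_def by (rule det_scale_rows)
  also have "\<dots> = (?e * sum_prod n indet) * alternant n (\<lambda>j. n - Suc j) indet"
    by (simp add: alternant_double_staircase mult_ac)
  finally have "schur_poly n (staircase (int n + 1)) = ?e * sum_prod n indet"
    by (intro schur_polyI) (simp add: nth_default_staircase nat_add_distrib)
  then show ?thesis
    by (simp add: schur_def[of _ "staircase (int n + 1)"] schur_staircase elem_sym_top_def
        sum_prod_def eval_cpoly_mult eval_cpoly_prod eval_cpoly_add eval_cpoly_indet)
qed

subsection \<open>The integral\<close>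

lemma sq_add_sq_factor: "(of_real x)\<^sup>2 + z\<^sup>2 = (of_real x - \<i> * z) * (of_real x + \<i> * z)"
proof -
  have "(of_real x)\<^sup>2 + z\<^sup>2 = (of_real x)\<^sup>2 - (\<i> * z)\<^sup>2"
    by (simp add: power_mult_distrib)
  then show ?thesis by (simp only: square_diff_square_factored power2_eq_square mult.commute)
qed

text \<open>The two linear factors have imaginary parts -Re z and Re z.\<close>

lemma norm_sq_add_sq_ge:
  assumes "Re z > 0"
  shows "norm ((of_real x)\<^sup>2 + z\<^sup>2) \<ge> (Re z)\<^sup>2"
proof -
  have "Re z \<le> norm (of_real x - \<i> * z)" "Re z \<le> norm (of_real x + \<i> * z)"
    using abs_Im_le_cmod[of "of_real x - \<i> * z"] abs_Im_le_cmod[of "of_real x + \<i> * z"] assms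
    by auto
  then have "Re z * Re z \<le> norm (of_real x - \<i> * z) * norm (of_real x + \<i> * z)"
    using assms by (intro mult_mono) auto
  then show ?thesis
    by (simp only: sq_add_sq_factor norm_mult power2_eq_square[of "Re z"])
qed

lemma sq_add_sq_nonzero:
  assumes "Re z > 0"
  shows "(of_real x)\<^sup>2 + z\<^sup>2 \<noteq> 0"
  using norm_sq_add_sq_ge[OF assms, of x] assms by (auto simp: not_le)

text \<open>The shift keeps the real parts of the linear factors and moves their imaginary parts
  away from 0.\<close>

lemma norm_sq_add_sq_mono:
  assumes "Re z \<ge> 0" "t \<ge> 0"
  shows "norm ((of_real x)\<^sup>2 + z\<^sup>2) \<le> norm ((of_real x)\<^sup>2 + (z + of_real t)\<^sup>2)"
proof -
  have "(Re z)\<^sup>2 \<le> (Re z + t)\<^sup>2"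
    using assms by (intro power_mono) auto
  then have "norm (of_real x - \<i> * z) \<le> norm (of_real x - \<i> * (z + of_real t))"
    "norm (of_real x + \<i> * z) \<le> norm (of_real x + \<i> * (z + of_real t))"
    by (auto simp: cmod_def power2_eq_square algebra_simps)
  then show ?thesis
    unfolding sq_add_sq_factor norm_mult by (intro mult_mono) auto
qed

text \<open>With w = x^2 + z^2, the triangle inequality bounds 1 + x^2 by |w| + |1 - z^2|, and the
  constant term is absorbed using |w| >= (Re z)^2.\<close>

lemma norm_inverse_sq_add_sq_le:
  assumes "Re z > 0"
  shows "norm (1 / ((of_real x)\<^sup>2 + z\<^sup>2)) \<le> (1 + norm (1 - z\<^sup>2) / (Re z)\<^sup>2) * inverse (1 + x\<^sup>2)"
proof -
  let ?w = "(of_real x)\<^sup>2 + z\<^sup>2"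
  have pos: "1 + x\<^sup>2 > 0" by (smt (verit) zero_le_power2)
  have "1 + x\<^sup>2 = norm (complex_of_real (1 + x\<^sup>2))"
    using pos by (simp only: norm_of_real)
  also have "complex_of_real (1 + x\<^sup>2) = ?w + (1 - z\<^sup>2)" by simp
  also have "norm \<dots> \<le> norm ?w + norm (1 - z\<^sup>2)" by (rule norm_triangle_ineq)
  also have "\<dots> \<le> norm ?w + norm (1 - z\<^sup>2) * (norm ?w / (Re z)\<^sup>2)"
    using norm_sq_add_sq_ge[OF assms, of x] assms
    by (intro add_left_mono mult_le_cancel_left1[THEN iffD2]) (auto simp: field_simps)
  also have "\<dots> = (1 + norm (1 - z\<^sup>2) / (Re z)\<^sup>2) * norm ?w"
    by (simp add: algebra_simps)
  finally have le: "1 + x\<^sup>2 \<le> \<dots>" .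
  have "norm ?w > 0"
    unfolding zero_less_norm_iff by (rule sq_add_sq_nonzero[OF assms])
  then have "1 / norm ?w \<le> (1 + norm (1 - z\<^sup>2) / (Re z)\<^sup>2) / (1 + x\<^sup>2)"
    using le pos by (simp only: pos_divide_le_eq pos_le_divide_eq mult_1 times_divide_eq_left)
  then show ?thesis
    by (simp only: norm_divide norm_one divide_inverse[of _ "1 + x\<^sup>2"])
qed

lemma set_integrable_inverse_1_sq: "set_integrable lborel {0..} (\<lambda>x::real. inverse (1 + x\<^sup>2))"
proof -
  have "set_integrable lborel (einterval 0 \<infinity>) (\<lambda>x::real. inverse (1 + x\<^sup>2))"
  proof (rule interval_integral_FTC_nonneg[where F = arctan])
    show "DERIV arctan x :> inverse (1 + x\<^sup>2)" for x :: real
      by (rule DERIV_arctan)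
    show "isCont (\<lambda>x. inverse (1 + x\<^sup>2)) x" for x :: real
      by (intro continuous_intros) (smt (verit) zero_le_power2)
    have "(arctan \<longlongrightarrow> arctan 0) (at_right 0)"
      by (intro tendsto_intros tendsto_ident_at)
    then show "((arctan \<circ> real_of_ereal) \<longlongrightarrow> 0) (at_right 0)"
      by (simp add: ereal_tendsto_simps zero_ereal_def)
    show "((arctan \<circ> real_of_ereal) \<longlongrightarrow> pi / 2) (at_left \<infinity>)"
      by (simp add: ereal_tendsto_simps tendsto_arctan_at_top)
  qed auto
  \<comment> \<open>The endpoint 0 is a null set.\<close>
  moreover have "set_integrable lborel {0<..} f \<longleftrightarrow> set_integrable lborel {0..} f"
    for f :: "real \<Rightarrow> real"
    by (rule set_integrable_discrete_difference[of "{0}"]) auto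
  moreover have "einterval 0 \<infinity> = {0::real<..}"
    by (auto simp: einterval_def)
  ultimately show ?thesis by simp
qed

text \<open>One factor supplies the decay at infinity; the others are bounded. A general
  \<open>K\<close> covers both the full product and a single factor.\<close>

lemma set_integrable_prod_inverse:
  assumes "finite K" "K \<noteq> {}" "\<And>k. k \<in> K \<Longrightarrow> Re (q k) > 0"
  shows "set_integrable lborel {0..} (\<lambda>x. \<Prod>k\<in>K. 1 / ((complex_of_real x)\<^sup>2 + (q k)\<^sup>2))"
proof -
  obtain k where k: "k \<in> K" using assms by auto
  define C where "C = (1 + norm (1 - (q k)\<^sup>2) / (Re (q k))\<^sup>2)
      * (\<Prod>j\<in>K-{k}. 1 / (Re (q j))\<^sup>2)"
  show ?thesis
  proof (rule set_integrable_bound)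
    show "set_integrable lborel {0..} (\<lambda>x. C * inverse (1 + x\<^sup>2))"
      by (intro set_integrable_mult_right impI set_integrable_inverse_1_sq)
    show "set_borel_measurable lborel {0..} (\<lambda>x. \<Prod>k\<in>K. 1 / ((complex_of_real x)\<^sup>2 + (q k)\<^sup>2))"
      unfolding set_borel_measurable_def by measurable
    have "norm (\<Prod>k\<in>K. 1 / ((complex_of_real x)\<^sup>2 + (q k)\<^sup>2)) \<le> C * inverse (1 + x\<^sup>2)" for x
    proof -
      have "norm (\<Prod>k\<in>K. 1 / ((complex_of_real x)\<^sup>2 + (q k)\<^sup>2))
          = norm (1 / ((complex_of_real x)\<^sup>2 + (q k)\<^sup>2))
            * (\<Prod>j\<in>K-{k}. norm (1 / ((complex_of_real x)\<^sup>2 + (q j)\<^sup>2)))"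
        by (simp only: prod.remove[OF \<open>finite K\<close> k] norm_mult prod_norm)
      also have "\<dots> \<le> ((1 + norm (1 - (q k)\<^sup>2) / (Re (q k))\<^sup>2) * inverse (1 + x\<^sup>2))
          * (\<Prod>j\<in>K-{k}. 1 / (Re (q j))\<^sup>2)"
      proof (intro mult_mono norm_inverse_sq_add_sq_le prod_mono conjI prod_nonneg)
        fix j assume j: "j \<in> K - {k}"
        show "norm (1 / ((complex_of_real x)\<^sup>2 + (q j)\<^sup>2)) \<le> 1 / (Re (q j))\<^sup>2"
          using norm_sq_add_sq_ge[of "q j" x] assms(3)[of j] j
          by (simp add: norm_divide frac_le)
      qed (use assms k in auto)
      finally show ?thesis by (simp add: C_def mult_ac)
    qed
    moreover have "C * inverse (1 + x\<^sup>2) \<le> norm (C * inverse (1 + x\<^sup>2))" for x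
      by simp
    ultimately show "AE x in lborel. x \<in> {0..} \<longrightarrow>
        norm (\<Prod>k\<in>K. 1 / ((complex_of_real x)\<^sup>2 + (q k)\<^sup>2)) \<le> norm (C * inverse (1 + x\<^sup>2))"
      using order.trans by blast
  qed
qed

section \<open>The integral in one variable\<close>

lemma integral_inverse_sq_add_sq:
  assumes z: "Re z > 0"
  shows "(LINT x:{0..}|lborel. 1 / ((complex_of_real x)\<^sup>2 + z\<^sup>2)) = of_real pi / (2 * z)"
proof -
  \<comment> \<open>Antiderivative from the partial fractions of 1 / (x^2 + z^2) over x - iz and x +
    iz.\<close>
  define F where "F x = (Ln (of_real x - \<i> * z) - Ln (of_real x + \<i> * z)) / (2 * \<i> * z)" for x :: real
  have nz: "z \<noteq> 0" "of_real x - \<i> * z \<noteq> 0" "of_real x + \<i> * z \<noteq> 0" for x :: real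
    using z by (auto simp: complex_eq_iff)
  \<comment> \<open>Both arguments have nonzero imaginary part, so the principal logarithms never
    meet the branch cut.\<close>
  have slit: "of_real x - \<i> * z \<notin> \<real>\<^sub>\<le>\<^sub>0" "of_real x + \<i> * z \<notin> \<real>\<^sub>\<le>\<^sub>0" for x :: real
    using z by (auto simp: complex_nonpos_Reals_iff)
  have deriv: "(F has_vector_derivative 1 / ((complex_of_real x)\<^sup>2 + z\<^sup>2)) (at x)" for x
  proof -
    have "((\<lambda>w. Ln (w - \<i> * z)) has_field_derivative 1 / (of_real x - \<i> * z)) (at (of_real x))"
      "((\<lambda>w. Ln (w + \<i> * z)) has_field_derivative 1 / (of_real x + \<i> * z)) (at (of_real x))"
      using slit[of x] by (auto intro!: derivative_eq_intros simp: divide_inverse)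
    then have "((\<lambda>w. (Ln (w - \<i> * z) - Ln (w + \<i> * z)) / (2 * \<i> * z)) has_field_derivative
        (1 / (of_real x - \<i> * z) - 1 / (of_real x + \<i> * z)) / (2 * \<i> * z)) (at (of_real x))"
      by (intro DERIV_cdivide DERIV_diff)
    also have "(1 / (of_real x - \<i> * z) - 1 / (of_real x + \<i> * z)) / (2 * \<i> * z)
        = 1 / ((complex_of_real x)\<^sup>2 + z\<^sup>2)"
      using nz(1) unfolding sq_add_sq_factor diff_frac_eq[OF nz(2,3)] by simp
    finally show ?thesis
      unfolding F_def by (rule has_vector_derivative_real_field)
  qed
  have cont: "continuous_on UNIV F"
    using deriv by (auto intro!: continuous_at_imp_continuous_on has_vector_derivative_continuous)
  \<comment> \<open>A positive real factor x may be pulled out of both logarithms; Ln x cancels and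
    the remaining arguments tend to 1.\<close>
  have "(F \<longlongrightarrow> 0) at_top"
  proof -
    have "((\<lambda>x::real. \<i> * z / of_real x) \<longlongrightarrow> 0) at_top"
      by (intro tendsto_divide_0[OF tendsto_const] filterlim_of_real_at_infinity)
    then have "((\<lambda>x::real. (Ln (1 - \<i> * z / of_real x) - Ln (1 + \<i> * z / of_real x)) / (2 * \<i> * z))
        \<longlongrightarrow> (Ln (1 - 0) - Ln (1 + 0)) / (2 * \<i> * z)) at_top"
      using nz(1) by (intro tendsto_intros) auto
    moreover have "\<forall>\<^sub>F x in at_top. (Ln (1 - \<i> * z / of_real x) - Ln (1 + \<i> * z / of_real x)) / (2 * \<i> * z) = F x"
      using eventually_gt_at_top[of 0]
    proof eventually_elim
      case (elim x)
      have "1 - \<i> * z / of_real x \<noteq> 0" "1 + \<i> * z / of_real x \<noteq> 0"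
        using elim nz(2,3)[of x] by (auto simp: field_simps)
      then have "Ln (of_real x * (1 - \<i> * z / of_real x)) = Ln (of_real x) + Ln (1 - \<i> * z / of_real x)"
        "Ln (of_real x * (1 + \<i> * z / of_real x)) = Ln (of_real x) + Ln (1 + \<i> * z / of_real x)"
        using elim by - (rule Ln_times_of_real; assumption)+
      moreover have "of_real x * (1 - \<i> * z / of_real x) = of_real x - \<i> * z"
        "of_real x * (1 + \<i> * z / of_real x) = of_real x + \<i> * z"
        using elim by (simp_all add: algebra_simps)
      ultimately show ?case by (simp add: F_def)
    qed
    ultimately show ?thesis using tendsto_cong by fastforce
  qed
  then have lim_top: "((F \<circ> real_of_ereal) \<longlongrightarrow> 0) (at_left \<infinity>)"
    by (simp add: ereal_tendsto_simps)
  \<comment> \<open>Since |arg z| < pi/2, rotation by a quarter turn either way stays on the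
    principal branch.\<close>
  have "Ln (\<i> * z) = Ln z + \<i> * of_real pi / 2" "Ln (- (\<i> * z)) = Ln z - \<i> * of_real pi / 2"
    using z nz(1) Ln_times_ii[OF nz(1)] Ln_minus[of "\<i> * z"] Re_Ln_pos_lt_imp[OF z] by auto
  then have "Ln (- (\<i> * z)) - Ln (\<i> * z) = \<i> * - of_real pi" by simp
  then have "F 0 = (\<i> * - of_real pi) / (\<i> * (2 * z))"
    by (simp only: F_def of_real_0 diff_0 add_0_left mult.commute[of 2 \<i>] mult.assoc)
  then have F0: "F 0 = - of_real pi / (2 * z)" by simp
  have "(F \<longlongrightarrow> F 0) (at_right 0)"
    using cont by (metis UNIV_I continuous_on filterlim_at_split iso_tuple_UNIV_I)
  then have lim_0: "((F \<circ> real_of_ereal) \<longlongrightarrow> F 0) (at_right 0)"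
    by (simp add: ereal_tendsto_simps zero_ereal_def)
  have "(LBINT x=0..\<infinity>. 1 / ((complex_of_real x)\<^sup>2 + z\<^sup>2)) = 0 - F 0"
  proof (rule interval_integral_FTC_integrable[where F = F])
    show "isCont (\<lambda>x. 1 / ((complex_of_real x)\<^sup>2 + z\<^sup>2)) x" for x
      using sq_add_sq_nonzero[OF z, of x] by (intro continuous_intros) auto
    have "set_integrable lborel {0..} (\<lambda>x. 1 / ((complex_of_real x)\<^sup>2 + z\<^sup>2))"
      using set_integrable_prod_inverse[of "{0}" "\<lambda>_. z"] z by simp
    then show "set_integrable lborel (einterval 0 \<infinity>) (\<lambda>x. 1 / ((complex_of_real x)\<^sup>2 + z\<^sup>2))"
      by (rule set_integrable_subset) (auto simp: einterval_def)
  qed (use deriv lim_top lim_0 in auto)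
  also have "(LBINT x=0..\<infinity>. 1 / ((complex_of_real x)\<^sup>2 + z\<^sup>2))
      = (LINT x:{0..}|lborel. 1 / ((complex_of_real x)\<^sup>2 + z\<^sup>2))"
    by (simp add: interval_integral_to_infinity_eq zero_ereal_def)
      (rule set_integral_discrete_difference[of "{0}"]; auto)
  finally show ?thesis by (simp add: F0)
qed

section \<open>Partial fractions by determinants\<close>

lemma det_replace_last_column:
  assumes n: "n \<ge> 1" and nz: "\<And>i. i < n \<Longrightarrow> w + y i \<noteq> (0 :: 'a::field)"
  shows "Determinant.det (Matrix.mat n n
        (\<lambda>(i, j). if j = n - 1 then 1 / (w + y i) else y i ^ (n - 2 - j)))
    = alternant n (\<lambda>j. n - Suc j) y * (\<Prod>i<n. 1 / (w + y i))"
proof -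
  let ?M = "Matrix.mat n n (\<lambda>(i, j). if j = n - 1 then 1 / (w + y i) else y i ^ (n - 2 - j))"
  let ?V = "Matrix.mat n n (\<lambda>(i, j). y i ^ (n - Suc j))"
  \<comment> \<open>Scaling row i by w + y_i turns column j < n - 1 into y^(n-1-j) + w y^(n-2-j) and
    the last column into 1. These are column operations on \<open>?V\<close>, recorded by the
    unitriangular \<open>?U\<close>.\<close>
  let ?U = "Matrix.mat n n (\<lambda>(i, j). of_bool (i = j) + w * of_bool (i = Suc j))"
  have entry: "(w + y i) * (if j = n - 1 then 1 / (w + y i) else y i ^ (n - 2 - j))
      = (\<Sum>k = 0..<n. y i ^ (n - Suc k) * (of_bool (k = j) + w * of_bool (k = Suc j)))"
    if "i < n" "j < n" for i j
  proof -
    have "(\<Sum>k = 0..<n. y i ^ (n - Suc k) * (of_bool (k = j) + w * of_bool (k = Suc j)))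
        = (\<Sum>k = 0..<n. if k = j then y i ^ (n - Suc k) else 0)
          + (\<Sum>k = 0..<n. if k = Suc j then w * y i ^ (n - Suc k) else 0)"
      unfolding sum.distrib[symmetric] by (intro sum.cong) (auto simp: distrib_left)
    also have "\<dots> = y i ^ (n - Suc j) + (if Suc j < n then w * y i ^ (n - Suc (Suc j)) else 0)"
      using that by (subst (1 2) sum.delta) auto
    also have "\<dots> = (w + y i) * (if j = n - 1 then 1 / (w + y i) else y i ^ (n - 2 - j))"
    proof (cases "Suc j < n")
      case True
      then have "n - Suc j = Suc (n - 2 - j)" "j \<noteq> n - 1" by auto
      with True show ?thesis by (simp add: algebra_simps)
    next
      case False
      then have "Suc j = n" using that by simp
      then show ?thesis using nz[OF that(1)] by auto
    qed
    finally show ?thesis by simp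
  qed
  have "Determinant.det ?U = prod_list (diag_mat ?U)"
    by (rule det_lower_triangular[of n]) auto
  also have "\<dots> = 1" by (simp add: prod_list_diag_prod)
  finally have U: "Determinant.det ?U = 1" .
  have "(\<Prod>i<n. w + y i) * Determinant.det ?M = Determinant.det (Matrix.mat n n
      (\<lambda>(i, j). (w + y i) * (if j = n - 1 then 1 / (w + y i) else y i ^ (n - 2 - j))))"
    by (rule det_scale_rows[symmetric])
  also have "Matrix.mat n n
      (\<lambda>(i, j). (w + y i) * (if j = n - 1 then 1 / (w + y i) else y i ^ (n - 2 - j))) = ?V * ?U"
    by (rule eq_matI) (use entry in \<open>auto simp: scalar_prod_def\<close>)
  also have "Determinant.det (?V * ?U) = alternant n (\<lambda>j. n - Suc j) y"
    by (simp only: det_mult[OF mat_carrier mat_carrier] U mult_1_right alternant_def)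
  finally have "(\<Prod>i<n. w + y i) * Determinant.det ?M = alternant n (\<lambda>j. n - Suc j) y" .
  moreover have "(\<Prod>i<n. w + y i) \<noteq> 0" using nz by auto
  ultimately have "Determinant.det ?M = alternant n (\<lambda>j. n - Suc j) y / (\<Prod>i<n. w + y i)"
    by (simp only: nonzero_eq_divide_eq not_False_eq_True mult.commute[of "Determinant.det ?M"])
  then show ?thesis
    by (simp only: prod_dividef prod.neutral_const times_divide_eq_right mult_1_right)
qed

text \<open>These coefficients depend only on the other columns, hence not on x: they stay constant
  under the integral.\<close>

definition last_cofactor :: "nat \<Rightarrow> (nat \<Rightarrow> 'a::comm_ring_1) \<Rightarrow> nat \<Rightarrow> 'a" where
  "last_cofactor n y i =
    cofactor (Matrix.mat n n (\<lambda>(i, j). y i ^ (n - 2 - j))) i (n - 1)"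

lemma det_expand_last_column:
  assumes "n \<ge> 1"
  shows "Determinant.det (Matrix.mat n n (\<lambda>(i, j). if j = n - 1 then f i else y i ^ (n - 2 - j)))
    = (\<Sum>i<n. f i * last_cofactor n y i)"
proof -
  let ?M = "Matrix.mat n n (\<lambda>(i, j). if j = n - 1 then f i else y i ^ (n - 2 - j))"
  have "mat_delete ?M i (n - 1) = mat_delete (Matrix.mat n n (\<lambda>(i, j). y i ^ (n - 2 - j))) i (n - 1)" for i
    by (rule eq_matI) (auto simp: mat_delete_def)
  then have "cofactor ?M i (n - 1) = last_cofactor n y i" for i
    by (simp only: last_cofactor_def cofactor_def)
  then show ?thesis
    using assms by (subst laplace_expansion_column[of _ n "n - 1"]) auto
qed

text \<open>Expanding along the last column, with w = x^2 and y_k = q_k^2, leaves one-variable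
  integrals; the factor 2/pi normalises each to 1 / q_k.\<close>

lemma G_mult_alternant:
  assumes n: "n \<ge> 1" and q: "\<And>k. k < n \<Longrightarrow> Re (q k) > 0"
  shows "G n q * alternant n (\<lambda>j. n - Suc j) (\<lambda>k. (q k)\<^sup>2)
    = (\<Sum>k<n. 1 / q k * last_cofactor n (\<lambda>k. (q k)\<^sup>2) k)"
proof -
  let ?D = "alternant n (\<lambda>j. n - Suc j) (\<lambda>k. (q k)\<^sup>2)"
  let ?C = "last_cofactor n (\<lambda>k. (q k)\<^sup>2)"
  have eq: "(\<Prod>k<n. 1 / ((complex_of_real x)\<^sup>2 + (q k)\<^sup>2)) * ?D
      = (\<Sum>k<n. 1 / ((complex_of_real x)\<^sup>2 + (q k)\<^sup>2) * ?C k)" for x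
    using det_replace_last_column[OF n sq_add_sq_nonzero[OF q]]
    by (simp only: det_expand_last_column[OF n] mult.commute[of ?D])
  have int: "set_integrable lborel {0..} (\<lambda>x. 1 / ((complex_of_real x)\<^sup>2 + (q k)\<^sup>2) * ?C k)"
    if "k < n" for k
    using set_integrable_prod_inverse[of "{k}" q] q[OF that]
    by (intro set_integrable_mult_left) auto
  have "(LINT x:{0..}|lborel. (\<Prod>k<n. 1 / ((complex_of_real x)\<^sup>2 + (q k)\<^sup>2))) * ?D
      = (LINT x:{0..}|lborel. (\<Sum>k<n. 1 / ((complex_of_real x)\<^sup>2 + (q k)\<^sup>2) * ?C k))"
    by (simp only: set_integral_mult_left[symmetric] eq)
  also have "\<dots> = (\<Sum>k<n. LINT x:{0..}|lborel. 1 / ((complex_of_real x)\<^sup>2 + (q k)\<^sup>2) * ?C k)"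
    using int unfolding set_lebesgue_integral_def set_integrable_def scaleR_sum_right
    by (intro Bochner_Integration.integral_sum) auto
  also have "\<dots> = (\<Sum>k<n. (LINT x:{0..}|lborel. 1 / ((complex_of_real x)\<^sup>2 + (q k)\<^sup>2)) * ?C k)"
    by (simp only: set_integral_mult_left)
  also have "\<dots> = (\<Sum>k<n. of_real pi / (2 * q k) * ?C k)"
    using q by (simp add: integral_inverse_sq_add_sq)
  finally have "G n q * ?D = of_real (2 / pi) * (\<Sum>k<n. of_real pi / (2 * q k) * ?C k)"
    by (simp add: G_def mult.assoc)
  also have "\<dots> = (\<Sum>k<n. 1 / q k * ?C k)"
    by (simp add: sum_distrib_left)
  finally show ?thesis .
qed

text \<open>The exponents are the odd numbers 2(n-2-j) + 1, except that truncation makes the last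
  one 0 instead of -1. Extracting q_i from row i leaves powers of q_i^2 and a last column 1 /
  q_i.\<close>

lemma alternant_staircase_pred:
  assumes n: "n \<ge> 1" and nz: "\<And>k. k < n \<Longrightarrow> q k \<noteq> (0 :: complex)"
  shows "alternant n (\<lambda>j. (n - 1 - Suc j) + (n - Suc j)) q
    = elem_sym_top n q * (\<Sum>k<n. 1 / q k * last_cofactor n (\<lambda>k. (q k)\<^sup>2) k)"
proof -
  have "q i ^ ((n - 1 - Suc j) + (n - Suc j))
      = q i * (if j = n - 1 then 1 / q i else (q i)\<^sup>2 ^ (n - 2 - j))" if "i < n" "j < n" for i j
  proof (cases "j = n - 1")
    case False
    with that have "(n - 1 - Suc j) + (n - Suc j) = Suc (2 * (n - 2 - j))" by auto
    then show ?thesis using False by (simp only: power_Suc power_mult if_False)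
  qed (use nz that in auto)
  then have "Matrix.mat n n (\<lambda>(i, j). q i ^ ((n - 1 - Suc j) + (n - Suc j)))
      = Matrix.mat n n (\<lambda>(i, j). q i * (if j = n - 1 then 1 / q i else (q i)\<^sup>2 ^ (n - 2 - j)))"
    by (intro eq_matI) auto
  then show ?thesis
    unfolding alternant_def elem_sym_top_def
    by (simp only: det_scale_rows det_expand_last_column[OF n])
qed

text \<open>Both sides agree after multiplication by the staircase alternant, which can be cancelled
  when the variables are distinct.\<close>

lemma G_mult_schur_generic:
  assumes n: "n \<ge> 1" and q: "\<And>k. k < n \<Longrightarrow> Re (q k) > 0" and d: "diff_prod n q \<noteq> 0"
  shows "G n q * (elem_sym_top n q * sum_prod n q) = schur n (staircase (int n - 1)) q"
proof -
  let ?c = "exchange_det n * diff_prod n q"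
  have c: "?c \<noteq> 0"
    using d exchange_det_square[of n, where 'a = complex] by auto
  have nz: "q k \<noteq> 0" if "k < n" for k
    using q[OF that] by auto
  have "nat (int n - 1) = n - 1" by linarith
  then have "schur n (staircase (int n - 1)) q * ?c
      = alternant n (\<lambda>j. (n - 1 - Suc j) + (n - Suc j)) q"
    by (simp add: schur_mult_alternant nth_default_staircase)
  also have "\<dots> = elem_sym_top n q * (G n q * alternant n (\<lambda>j. n - Suc j) (\<lambda>k. (q k)\<^sup>2))"
    by (simp only: alternant_staircase_pred[OF n nz] G_mult_alternant[OF n q])
  also have "\<dots> = G n q * (elem_sym_top n q * sum_prod n q) * ?c"
    by (simp add: alternant_staircase diff_prod_square mult_ac)
  finally show ?thesis using c by simp
qed

section \<open>From distinct to arbitrary variables\<close>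

lemma tendsto_G:
  assumes n: "n \<ge> 1" and q: "\<And>k. k < n \<Longrightarrow> Re (q k) > 0"
    and t: "\<And>m k. t m k \<ge> 0" "\<And>k. (\<lambda>m. t m k) \<longlonglongrightarrow> 0"
  shows "(\<lambda>m. G n (\<lambda>k. q k + of_real (t m k))) \<longlonglongrightarrow> G n q"
proof -
  let ?f = "\<lambda>q x. \<Prod>k<n. 1 / ((complex_of_real x)\<^sup>2 + (q k)\<^sup>2)"
  let ?q = "\<lambda>m k. q k + of_real (t m k)"
  have "(\<lambda>m. LINT x|lborel. indicator {0..} x *\<^sub>R ?f (?q m) x)
      \<longlonglongrightarrow> (LINT x|lborel. indicator {0..} x *\<^sub>R ?f q x)"
  proof (rule integral_dominated_convergence)
    have "integrable lborel (\<lambda>x. indicator {0..} x *\<^sub>R ?f q x)"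
      using set_integrable_prod_inverse[of "{..<n}" q] n q
      by (auto simp: set_integrable_def lessThan_empty_iff)
    then show "integrable lborel (\<lambda>x. norm (indicator {0..} x *\<^sub>R ?f q x))"
      by (rule integrable_norm)
    show "AE x in lborel. (\<lambda>m. indicator {0..} x *\<^sub>R ?f (?q m) x) \<longlonglongrightarrow> indicator {0..} x *\<^sub>R ?f q x"
    proof (intro AE_I2)
      fix x :: real
      have "(\<lambda>m. ?q m k) \<longlonglongrightarrow> q k + of_real 0" for k
        by (intro tendsto_intros t)
      then have "(\<lambda>m. 1 / ((complex_of_real x)\<^sup>2 + (?q m k)\<^sup>2)) \<longlonglongrightarrow> 1 / ((complex_of_real x)\<^sup>2 + (q k)\<^sup>2)"
        if "k < n" for k
        by (intro tendsto_intros sq_add_sq_nonzero q that) simp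
      then show "(\<lambda>m. indicator {0..} x *\<^sub>R ?f (?q m) x) \<longlonglongrightarrow> indicator {0..} x *\<^sub>R ?f q x"
        by (intro tendsto_scaleR tendsto_const tendsto_prod) auto
    qed
    show "AE x in lborel. norm (indicator {0..} x *\<^sub>R ?f (?q m) x)
        \<le> norm (indicator {0..} x *\<^sub>R ?f q x)" for m
    proof (intro AE_I2)
      fix x :: real
      have "norm (1 / ((complex_of_real x)\<^sup>2 + (?q m k)\<^sup>2)) \<le> norm (1 / ((complex_of_real x)\<^sup>2 + (q k)\<^sup>2))"
        if "k < n" for k
        unfolding norm_divide norm_one
        using norm_sq_add_sq_mono[of "q k" "t m k" x] q[OF that] t(1) sq_add_sq_nonzero[OF q[OF that]]
        by (intro divide_left_mono mult_pos_pos zero_less_norm_iff[THEN iffD2] sq_add_sq_nonzero)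
          (auto simp: add_pos_nonneg)
      then have "norm (?f (?q m) x) \<le> norm (?f q x)"
        unfolding prod_norm[symmetric] by (intro prod_mono) auto
      then show "norm (indicator {0..} x *\<^sub>R ?f (?q m) x) \<le> norm (indicator {0..} x *\<^sub>R ?f q x)"
        by (auto simp: indicator_def)
    qed
  qed measurable
  then show ?thesis
    unfolding G_def set_lebesgue_integral_def by (intro tendsto_mult tendsto_const)
qed

text \<open>Coinciding variables are separated by their different shifts for every m; distinct ones
  stay distinct once the shifts are small. Only finitely many pairs occur.\<close>

lemma eventually_diff_prod_nonzero:
  fixes q :: "nat \<Rightarrow> complex"
  shows "\<forall>\<^sub>F m in sequentially. diff_prod n (\<lambda>k. q k + of_real (real k / real (Suc m))) \<noteq> 0"
proof -
  have pair: "\<forall>\<^sub>F m in sequentially.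
      q i + of_real (real i / real (Suc m)) \<noteq> q l + of_real (real l / real (Suc m))"
    if "l < i" for i l
  proof (cases "q i = q l")
    case True
    then show ?thesis
      using that by (auto simp: divide_cancel_right simp del: of_real_divide)
  next
    case False
    have lim: "(\<lambda>m. complex_of_real (real i / real (Suc m))) \<longlonglongrightarrow> of_real 0" for i
      by (intro tendsto_of_real LIMSEQ_Suc lim_const_over_n)
    have "(\<lambda>m. (q i + of_real (real i / real (Suc m))) - (q l + of_real (real l / real (Suc m))))
        \<longlonglongrightarrow> (q i + of_real 0) - (q l + of_real 0)"
      by (intro tendsto_intros lim)
    then have "\<forall>\<^sub>F m in sequentially.
        (q i + of_real (real i / real (Suc m))) - (q l + of_real (real l / real (Suc m))) \<noteq> 0"
      by (rule tendsto_imp_eventually_ne) (use False in simp)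
    then show ?thesis by eventually_elim simp
  qed
  have "\<forall>\<^sub>F m in sequentially. \<forall>i\<in>{..<n}. \<forall>l\<in>{..<i}.
      q i + of_real (real i / real (Suc m)) \<noteq> q l + of_real (real l / real (Suc m))"
    by (intro eventually_ball_finite ballI finite_lessThan pair) simp
  then show ?thesis
    by eventually_elim (auto simp: diff_prod_def)
qed

text \<open>The Schur side is the evaluation of a fixed polynomial, hence continuous, so the generic
  identity survives in the limit.\<close>

lemma G_mult_schur:
  assumes n: "n \<ge> 1" and q: "\<And>k. k < n \<Longrightarrow> Re (q k) > 0"
  shows "G n q * (elem_sym_top n q * sum_prod n q) = schur n (staircase (int n - 1)) q"
proof (rule LIMSEQ_unique)
  let ?q = "\<lambda>m k. q k + of_real (real k / real (Suc m))"
  have t: "(\<lambda>m. real k / real (Suc m)) \<longlonglongrightarrow> 0" for k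
    by (intro LIMSEQ_Suc lim_const_over_n)
  have lim: "(\<lambda>m. ?q m k) \<longlonglongrightarrow> q k" for k
    using tendsto_add[OF tendsto_const[of "q k"] tendsto_of_real[OF t[of k]]]
    by (simp only: of_real_0 add_0_right)
  show "(\<lambda>m. schur n (staircase (int n - 1)) (?q m)) \<longlonglongrightarrow> schur n (staircase (int n - 1)) q"
    unfolding schur_def by (intro tendsto_eval_cpoly lim)
  have "(\<lambda>m. G n (?q m) * (elem_sym_top n (?q m) * sum_prod n (?q m)))
      \<longlonglongrightarrow> G n q * (elem_sym_top n q * sum_prod n q)"
    unfolding elem_sym_top_def sum_prod_def
    by (intro tendsto_mult tendsto_prod tendsto_add lim tendsto_G n q t) auto
  moreover have "\<forall>\<^sub>F m in sequentially. G n (?q m) * (elem_sym_top n (?q m) * sum_prod n (?q m))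
      = schur n (staircase (int n - 1)) (?q m)"
    using eventually_diff_prod_nonzero[of n q]
    by eventually_elim (intro G_mult_schur_generic n, auto simp: q add_pos_nonneg)
  ultimately show "(\<lambda>m. schur n (staircase (int n - 1)) (?q m))
      \<longlonglongrightarrow> G n q * (elem_sym_top n q * sum_prod n q)"
    by (rule Lim_transform_eventually)
qed

theorem theorem5p1:
  fixes n :: nat and q :: "nat \<Rightarrow> complex"
  assumes "n \<ge> 1"
    and "\<And>k. k < n \<Longrightarrow> Re (q k) > 0"
  shows "G n q = schur n (staircase (int n - 1)) q / schur n (staircase (int n + 1)) q
    \<and> schur n (staircase (int n - 1)) q / schur n (staircase (int n + 1)) q
      = schur n (staircase (int n - 1)) q / (elem_sym_top n q * schur n (staircase (int n)) q)"
proof -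
  have "q k \<noteq> 0" if "k < n" for k
    using assms(2)[OF that] by auto
  \<comment> \<open>The sum has positive real part, so the denominator in the theorem is
    nonzero.\<close>
  moreover have "q i + q l \<noteq> 0" if "i < n" "l < i" for i l
    using assms(2)[of i] assms(2)[of l] that by (auto simp: complex_eq_iff)
  ultimately have "elem_sym_top n q * sum_prod n q \<noteq> 0"
    by (auto simp: elem_sym_top_def sum_prod_def)
  moreover have "G n q * (elem_sym_top n q * sum_prod n q) = schur n (staircase (int n - 1)) q"
    using assms by (intro G_mult_schur)
  ultimately show ?thesis
    by (simp only: schur_staircase_Suc schur_staircase nonzero_eq_divide_eq simp_thms)
qed

end
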